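(* Let $\mathcal{B}\subset\mathcal{A}$ be an inclusion of unital $C^*$-algebras (with common unit) with a finite-index conditional expectation $E:\mathcal{A}\to\mathcal{B}$. Then there exists a constant $\alpha>0$ such that $$\{u\in\mathcal{N}_{\mathcal{A}}(\mathcal{B}):\|u-\mathbf{1}\|<\alpha\}\subseteq\bigcap\{\mathcal{N}_{\mathcal{A}}(\mathcal{C}):\mathcal{C}\in\mathcal{F}(\mathcal{B},\mathcal{A},E)\}.$$ In particular, if $\mathcal{C}_{\mathcal{A}}(\mathcal{B})\subseteq\mathcal{B}$, then $$\{u\in\mathcal{N}_{\mathcal{A}}(\mathcal{B}):\|u-\mathbf{1}\|<\alpha\}\subseteq\bigcap\{\mathcal{N}_{\mathcal{A}}(\mathcal{C}):\mathcal{C}\in\mathrm{IMS}(\mathcal{B},\mathcal{A},E)\}.$$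
   Context: $\mathcal{U}(\mathcal{A})$ is the unitary group of $\mathcal{A}$; $\mathcal{N}_{\mathcal{A}}(\mathcal{C})=\{u\in\mathcal{U}(\mathcal{A}):u\mathcal{C}u^*=\mathcal{C}\}$; $\mathcal{C}_{\mathcal{A}}(\mathcal{C})=\{x\in\mathcal{A}:cx=xc\ \forall c\in\mathcal{C}\}$. A conditional expectation $E:\mathcal{A}\to\mathcal{B}$ has finite index if there is a finite set $\{\lambda_1,\dots,\lambda_n\}\subset\mathcal{A}$ with $x=\sum_iE(x\lambda_i)\lambda_i^*$ for all $x\in\mathcal{A}$. $\mathrm{IMS}(\mathcal{B},\mathcal{A},E)$ is the set of intermediate $C^*$-subalgebras $\mathcal{B}\subseteq\mathcal{C}\subseteq\mathcal{A}$ admitting a conditional expectation $F$ from $\mathcal{A}$ onto $\mathcal{C}$ with $E|_{\mathcal{C}}\circ F=E$. $\mathcal{F}(\mathcal{B},\mathcal{A},E)=\{\mathcal{C}\in\mathrm{IMS}(\mathcal{B},\mathcal{A},E):\mathcal{C}_{\mathcal{A}}(\mathcal{B})\subseteq\mathcal{C}_{\mathcal{A}}(\mathcal{C})\cup\mathcal{C}\}$. *)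

theory Defs
  imports "HOL-Analysis.Analysis"
begin

text \<open>
  Unital \<open>C\<^sup>*\<close>-algebras. The ambient algebra is a type of the following class, and its subalgebras
  are subsets of that type. The superclasses provide completeness, submultiplicativity of the norm,
  \<open>1 \<noteq> 0\<close> and \<open>norm 1 = 1\<close>; the last holds in every nonzero unital \<open>C\<^sup>*\<close>-algebra.
\<close>

class unital_cstar_algebra = real_normed_algebra_1 + banach +
  fixes scaleC :: "complex \<Rightarrow> 'a \<Rightarrow> 'a"  (infixr \<open>*\<^sub>C\<close> 75)
    and adj :: "'a \<Rightarrow> 'a"
  assumes scaleC_add_right: "a *\<^sub>C (x + y) = a *\<^sub>C x + a *\<^sub>C y"
    and scaleC_add_left: "(a + b) *\<^sub>C x = a *\<^sub>C x + b *\<^sub>C x"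
    and scaleC_scaleC: "a *\<^sub>C b *\<^sub>C x = (a * b) *\<^sub>C x"
    and scaleC_of_real: "complex_of_real r *\<^sub>C x = r *\<^sub>R x"
    and mult_scaleC_left: "(a *\<^sub>C x) * y = a *\<^sub>C (x * y)"
    and mult_scaleC_right: "x * (a *\<^sub>C y) = a *\<^sub>C (x * y)"
    and norm_scaleC: "norm (a *\<^sub>C x) = cmod a * norm x"
    and adj_adj: "adj (adj x) = x"
    and adj_add: "adj (x + y) = adj x + adj y"
    and adj_scaleC: "adj (a *\<^sub>C x) = cnj a *\<^sub>C adj x"
    and adj_mult: "adj (x * y) = adj y * adj x"
    and cstar_identity: "norm (adj x * x) = (norm x)\<^sup>2"

definition cstar_subalgebra :: "'a::unital_cstar_algebra set \<Rightarrow> bool" where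
  "cstar_subalgebra C \<longleftrightarrow>
     closed C \<and> 0 \<in> C \<and>
     (\<forall>x\<in>C. \<forall>y\<in>C. x + y \<in> C) \<and>
     (\<forall>a. \<forall>x\<in>C. a *\<^sub>C x \<in> C) \<and>
     (\<forall>x\<in>C. \<forall>y\<in>C. x * y \<in> C) \<and>
     (\<forall>x\<in>C. adj x \<in> C)"

definition unitaries :: "'a::unital_cstar_algebra set" where
  "unitaries = {u. adj u * u = 1 \<and> u * adj u = 1}"

definition normalizer :: "'a::unital_cstar_algebra set \<Rightarrow> 'a set" where
  "normalizer C = {u \<in> unitaries. (\<lambda>c. u * c * adj u) ` C = C}"

definition relative_commutant :: "'a::unital_cstar_algebra set \<Rightarrow> 'a set" where
  "relative_commutant C = {x. \<forall>c\<in>C. c * x = x * c}"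

definition positive_cone :: "'a::unital_cstar_algebra set \<Rightarrow> 'a set" where
  "positive_cone C = {adj y * y | y. y \<in> C}"

text \<open>
  \<open>conditional_expectation C F\<close>: \<open>F\<close> is a conditional expectation of the whole algebra onto its
  \<open>C\<^sup>*\<close>-subalgebra \<open>C\<close>, i.e. a positive contractive linear \<open>C\<close>-bimodule projection onto \<open>C\<close>.
\<close>

definition conditional_expectation ::
    "'a::unital_cstar_algebra set \<Rightarrow> ('a \<Rightarrow> 'a) \<Rightarrow> bool" where
  "conditional_expectation C F \<longleftrightarrow>
     (\<forall>x y. F (x + y) = F x + F y) \<and>
     (\<forall>a x. F (a *\<^sub>C x) = a *\<^sub>C F x) \<and>
     (\<forall>x. F x \<in> C) \<and>
     (\<forall>c\<in>C. F c = c) \<and>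
     (\<forall>b\<in>C. \<forall>c\<in>C. \<forall>x. F (b * x * c) = b * F x * c) \<and>
     F ` positive_cone UNIV \<subseteq> positive_cone C \<and>
     (\<forall>x. norm (F x) \<le> norm x)"

definition finite_index :: "('a::unital_cstar_algebra \<Rightarrow> 'a) \<Rightarrow> bool" where
  "finite_index E \<longleftrightarrow>
     (\<exists>(n::nat) l::nat \<Rightarrow> 'a. \<forall>x. x = (\<Sum>i=1..n. E (x * l i) * adj (l i)))"

definition IMS :: "'a::unital_cstar_algebra set \<Rightarrow> ('a \<Rightarrow> 'a) \<Rightarrow> 'a set set" where
  "IMS B E = {C. cstar_subalgebra C \<and> B \<subseteq> C \<and>
     (\<exists>F. conditional_expectation C F \<and> (\<forall>x. E (F x) = E x))}"

definition IMS_F :: "'a::unital_cstar_algebra set \<Rightarrow> ('a \<Rightarrow> 'a) \<Rightarrow> 'a set set" where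
  "IMS_F B E = {C \<in> IMS B E. relative_commutant B \<subseteq> relative_commutant C \<union> C}"

end

theory Submission
  imports Defs
begin

text \<open>
  Let \<open>u\<close> normalize \<open>B\<close> with \<open>\<parallel>u - 1\<parallel> < 1\<close>. Applying \<open>E\<close> to \<open>u b = (u b u\<^sup>*) u\<close> shows that
  \<open>w = E u\<close> satisfies \<open>w b = (u b u\<^sup>*) w\<close> for \<open>b \<in> B\<close>, and \<open>w\<close> is invertible in \<open>B\<close> because
  \<open>\<parallel>w - 1\<parallel> < 1\<close>. Hence \<open>x = w\<^sup>-\<^sup>1 u\<close> commutes with \<open>B\<close>. If \<open>C\<close> belongs to \<open>IMS_F B E\<close>, then \<open>x\<close>
  lies in \<open>C\<close> or commutes with \<open>C\<close>; in both cases \<open>u = w x\<close> normalizes \<open>C\<close>. So \<open>\<alpha> = 1\<close> works.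
\<close>

text \<open>The inverse is the Neumann series in \<open>1 - w\<close>: its partial sums stay in
  \<open>B\<close>, hence so does the limit. Having it in \<open>B\<close> puts it in every
  intermediate algebra.\<close>

lemma neumann_inverse_in_closed_subalgebra:
  fixes w :: "'a::{real_normed_algebra_1, banach}"
  assumes "closed B" and "1 \<in> B"
    and add: "\<And>x y. x \<in> B \<Longrightarrow> y \<in> B \<Longrightarrow> x + y \<in> B"
    and mult: "\<And>x y. x \<in> B \<Longrightarrow> y \<in> B \<Longrightarrow> x * y \<in> B"
    and "1 - w \<in> B" and "norm (1 - w) < 1"
  shows "\<exists>v\<in>B. v * w = 1 \<and> w * v = 1"
proof -
  define z where "z = 1 - w"
  have z: "z \<in> B" "norm z < 1" using assms by (auto simp: z_def)
  have summ: "summable (\<lambda>n. z ^ n)"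
    using z(2) by (rule complete_algebra_summable_geometric)
  define v where "v = (\<Sum>n. z ^ n)"
  have zpow: "z ^ n \<in> B" for n
    by (induction n) (use z(1) assms(2) mult in auto)
  \<comment> \<open>Running up to \<open>Suc n\<close> keeps the sums nonempty, as
    \<open>0 \<in> B\<close> is not among the hypotheses.\<close>
  have partial_sums: "(\<Sum>i<Suc n. z ^ i) \<in> B" for n
  proof (induction n)
    case 0
    then show ?case using assms(2) by simp
  next
    case (Suc n)
    then show ?case using add[OF Suc zpow[of "Suc n"]] by simp
  qed
  have "(\<lambda>n. \<Sum>i<Suc n. z ^ i) \<longlonglongrightarrow> v"
    using summable_LIMSEQ[OF summ] unfolding v_def by (rule LIMSEQ_Suc)
  then have "v \<in> B"
    by (rule closed_sequentially[OF assms(1) partial_sums])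
  \<comment> \<open>Multiplying the series by \<open>z\<close> on either side shifts it by one
    index, so both products equal \<open>v - 1\<close>.\<close>
  have head: "(\<Sum>n. z ^ Suc n) = v - 1"
    using suminf_split_head[OF summ] by (simp add: v_def)
  have "z * v = v - 1"
    using suminf_mult[OF summ, of z] head by (simp add: v_def)
  moreover have "v * z = v - 1"
    using suminf_mult2[OF summ, of z] head by (simp add: v_def power_commutes)
  ultimately have "v * w = 1 \<and> w * v = 1"
    by (simp add: z_def algebra_simps)
  with \<open>v \<in> B\<close> show ?thesis by blast
qed

lemma unitary_in_subalgebra_normalizes:
  assumes "cstar_subalgebra C" and "u \<in> unitaries" and "u \<in> C"
  shows "u \<in> normalizer C"
proof -
  have "adj u \<in> C" and mult: "\<And>x y. x \<in> C \<Longrightarrow> y \<in> C \<Longrightarrow> x * y \<in> C"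
    using assms by (auto simp: cstar_subalgebra_def)
  have u: "adj u * u = 1" "u * adj u = 1"
    using assms(2) by (auto simp: unitaries_def)
  have "c \<in> (\<lambda>c. u * c * adj u) ` C" if "c \<in> C" for c
  proof
    show "adj u * c * u \<in> C" using that \<open>adj u \<in> C\<close> \<open>u \<in> C\<close> mult by simp
    have "u * (adj u * c * u) * adj u = (u * adj u) * c * (u * adj u)"
      by (simp only: mult.assoc)
    then show "c = u * (adj u * c * u) * adj u" using u by simp
  qed
  then show ?thesis
    using assms(2,3) \<open>adj u \<in> C\<close> mult by (auto simp: normalizer_def)
qed

text \<open>In \<open>u = w * (v * u)\<close> the factor \<open>v * u\<close> commutes with
  \<open>C\<close>, so \<open>u\<close> acts on \<open>C\<close> by conjugation as the invertible
  \<open>w \<in> C\<close> does, even if \<open>w\<close> is not unitary.\<close>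

lemma unitary_normalizes_if_inner_on_subalgebra:
  assumes "cstar_subalgebra C" and "u \<in> unitaries"
    and "w \<in> C" "v \<in> C" "v * w = 1" "w * v = 1"
    and commute: "v * u \<in> relative_commutant C"
  shows "u \<in> normalizer C"
proof -
  have mult: "\<And>x y. x \<in> C \<Longrightarrow> y \<in> C \<Longrightarrow> x * y \<in> C"
    using assms(1) by (auto simp: cstar_subalgebra_def)
  have conj: "u * c * adj u = w * c * v" if "c \<in> C" for c
  proof -
    have "u * c * adj u = w * ((v * u) * c) * adj u"
      using assms(6) by (simp flip: mult.assoc)
    also have "\<dots> = w * (c * (v * u)) * adj u"
      using commute that by (simp add: relative_commutant_def)
    also have "\<dots> = w * c * v * (u * adj u)"
      by (simp only: mult.assoc)
    finally show ?thesis using assms(2) by (simp add: unitaries_def)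
  qed
  have "c \<in> (\<lambda>c. u * c * adj u) ` C" if "c \<in> C" for c
  proof
    show "v * c * w \<in> C" using that assms mult by simp
    then have "u * (v * c * w) * adj u = w * (v * c * w) * v"
      by (rule conj)
    also have "\<dots> = (w * v) * c * (w * v)"
      by (simp only: mult.assoc)
    finally show "c = u * (v * c * w) * adj u" using assms by simp
  qed
  then show ?thesis
    using assms conj mult by (auto simp: normalizer_def)
qed

text \<open>The factors come from \<open>E\<close> and \<open>u\<close> alone, so they serve all
  intermediate algebras at once and the bound is uniform.\<close>

lemma near_one_normalizer_factorization:
  assumes B: "cstar_subalgebra B" "1 \<in> B" and E: "conditional_expectation B E"
    and u: "u \<in> normalizer B" "norm (u - 1) < 1"
  shows "\<exists>w\<in>B. \<exists>v\<in>B. v * w = 1 \<and> w * v = 1 \<and> v * u \<in> relative_commutant B"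
proof -
  have add: "\<And>x y. x \<in> B \<Longrightarrow> y \<in> B \<Longrightarrow> x + y \<in> B"
    and mult: "\<And>x y. x \<in> B \<Longrightarrow> y \<in> B \<Longrightarrow> x * y \<in> B"
    and "closed B"
    using B(1) by (auto simp: cstar_subalgebra_def)
  have E_add: "E (x + y) = E x + E y" and E_in: "E x \<in> B"
    and E_contr: "norm (E x) \<le> norm x" for x y
    using E by (auto simp: conditional_expectation_def)
  have E_bimod: "E (b * x * c) = b * E x * c" if "b \<in> B" "c \<in> B" for b x c
    using E that by (auto simp: conditional_expectation_def)
  have "E 1 = 1" using E B(2) by (auto simp: conditional_expectation_def)
  have "E (1 - u) + E u = 1"
    using E_add[of "1 - u" u] \<open>E 1 = 1\<close> by simp
  then have diff: "1 - E u = E (1 - u)"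
    by (simp add: algebra_simps)
  \<comment> \<open>\<open>E\<close> fixes \<open>1\<close> and is contractive, so
    \<open>E u\<close> is at least as close to \<open>1\<close> as \<open>u\<close> is.\<close>
  have "norm (1 - E u) < 1"
    using E_contr[of "1 - u"] u(2) by (simp add: diff norm_minus_commute)
  moreover have "1 - E u \<in> B" using E_in diff by simp
  ultimately obtain v where v: "v \<in> B" "v * E u = 1" "E u * v = 1"
    using neumann_inverse_in_closed_subalgebra[OF \<open>closed B\<close> B(2) add mult] by blast
  have "b * (v * u) = (v * u) * b" if "b \<in> B" for b
  proof -
    define s where "s = u * b * adj u"
    have "s \<in> B" using u(1) that by (auto simp: normalizer_def s_def)
    have "s * u = u * b * (adj u * u)" by (simp only: s_def mult.assoc)
    then have su: "s * u = u * b"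
      using u(1) by (simp add: normalizer_def unitaries_def)
    \<comment> \<open>Apply \<open>E\<close> to \<open>s * u = u * b\<close>, using the bimodule
      property with \<open>1\<close> as the other outer factor.\<close>
    have "s * E u = E u * b"
      using E_bimod[OF \<open>s \<in> B\<close> B(2), of u] E_bimod[OF B(2) that, of u] su by simp
    \<comment> \<open>Multiplying by \<open>v\<close> on both sides gives the reversed relation
      \<open>v * s = b * v\<close> for the inverse.\<close>
    then have "v * (s * E u) * v = v * (E u * b) * v" by simp
    then have "v * s * (E u * v) = (v * E u) * b * v" by (simp only: mult.assoc)
    then have "v * s = b * v" using v by simp
    then have "b * v * u = v * (s * u)" by (simp flip: mult.assoc)
    then show ?thesis by (simp add: su mult.assoc)
  qed
  then show ?thesis using v E_in by (auto simp: relative_commutant_def)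
qed

theorem corollary3p7:
  fixes B :: "'a::unital_cstar_algebra set"
    and E :: "'a \<Rightarrow> 'a"
  assumes "cstar_subalgebra B"
    and "1 \<in> B"
    and "conditional_expectation B E"
    and "finite_index E"
  shows "\<exists>\<alpha>>0.
    {u \<in> normalizer B. norm (u - 1) < \<alpha>} \<subseteq> (\<Inter>C\<in>IMS_F B E. normalizer C) \<and>
    (relative_commutant B \<subseteq> B \<longrightarrow>
      {u \<in> normalizer B. norm (u - 1) < \<alpha>} \<subseteq> (\<Inter>C\<in>IMS B E. normalizer C))"
proof -
  have main: "u \<in> normalizer C"
    if u: "u \<in> normalizer B" "norm (u - 1) < 1" and C: "C \<in> IMS_F B E" for u C
  proof -
    have sub: "cstar_subalgebra C" "B \<subseteq> C" "relative_commutant B \<subseteq> relative_commutant C \<union> C"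
      using C by (auto simp: IMS_F_def IMS_def)
    have un: "u \<in> unitaries" using u(1) by (simp add: normalizer_def)
    obtain w v where wv: "w \<in> C" "v \<in> C" "v * w = 1" "w * v = 1"
      and x: "v * u \<in> relative_commutant B"
      using near_one_normalizer_factorization[OF assms(1-3) u] sub(2) by blast
    from x sub(3) consider "v * u \<in> relative_commutant C" | "v * u \<in> C" by blast
    then show ?thesis
    proof cases
      case 1
      then show ?thesis
        using unitary_normalizes_if_inner_on_subalgebra[OF sub(1) un wv] by blast
    next
      case 2
      have "u = w * (v * u)" using wv(4) by (simp flip: mult.assoc)
      also have "\<dots> \<in> C" using 2 wv(1) sub(1) by (simp add: cstar_subalgebra_def)
      finally show ?thesis
        using unitary_in_subalgebra_normalizes[OF sub(1) un] by blast
    qed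
  qed
  \<comment> \<open>Here the relative commutant of \<open>B\<close> lies in \<open>B\<close>, hence
    in every intermediate \<open>C\<close>.\<close>
  have "IMS B E \<subseteq> IMS_F B E" if "relative_commutant B \<subseteq> B"
    using that by (auto simp: IMS_F_def IMS_def)
  with main show ?thesis
    by (intro exI[of _ 1]) (auto simp: subset_iff)
qed

end
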